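(* Let $\alpha\in BV[a,b]$ and let $\{f_n\}_{n=1}^\infty$ be a uniformly bounded sequence of functions on $[a,b]$ such that $f_n\in RDS_\alpha[a,b]$ for all $n\in\mathbb N$, $f_n\to f$ pointwise on $[a,b]$ as $n\to\infty$, and $f\in RDS_\alpha[a,b]$. Then $$\lim_{n\to\infty}\int_a^b f_n(x)\,d\alpha=\int_a^b f(x)\,d\alpha .$$
   Context: Fix reals $a<b$. $B[a,b]$, $I[a,b]$, $BV[a,b]$ denote the bounded, the increasing (nondecreasing), and the bounded-variation real functions on $[a,b]$. $\alpha(x\pm)$ are one-sided limits, with the convention $\alpha(a-)=\alpha(a)$, $\alpha(b+)=\alpha(b)$. A partition is $\mathcal P=\{x_i\}_{i=0}^n$ with $a=x_0<\dots<x_n=b$; $I_i=(x_{i-1},x_i)$. Set $\mu_\alpha((c,d))=\alpha(d-)-\alpha(c+)$ and $\mu_\alpha(\{c\})=\alpha(c+)-\alpha(c-)$. A step function $u\in S[a,b]$ is a bounded function which, for some partition, equals a constant $c_i$ on each $I_i$ (values at partition points arbitrary); its integral is $\int_a^b u\,d\alpha=\sum_{i=0}^n u(x_i)\mu_\alpha(\{x_i\})+\sum_{i=1}^n c_i\mu_\alpha(I_i)$ (independent of the partition). RDS integral: for $\alpha\in I[a,b]$, $f\in B[a,b]$, let $L_\alpha(f,[a,b])=\sup\{\int_a^b v\,d\alpha: v\in S[a,b], v\le f\}$ and $U_\alpha(f,[a,b])=\inf\{\int_a^b u\,d\alpha: u\in S[a,b], u\ge f\}$. Write $f\in RDS_\alpha[a,b]$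 if these are equal; the common value is $\int_a^b f(x)\,d\alpha$. For $\alpha\in BV[a,b]$, $f\in RDS_\alpha[a,b]$ if there is a decomposition $\alpha=\alpha^+-\alpha^-$ with $\alpha^\pm\in I[a,b]$ and $f\in RDS_{\alpha^+}[a,b]\cap RDS_{\alpha^-}[a,b]$; then $\int_a^b f\,d\alpha=\int_a^b f\,d\alpha^+-\int_a^b f\,d\alpha^-$ (independent of the decomposition). *)

theory Defs
  imports "HOL-Analysis.Analysis"
begin

text \<open>
  Functions on \<open>[a,b]\<close> are represented by total functions \<^typ>\<open>real \<Rightarrow> real\<close>; every notion below depends
  only on their values on \<open>{a..b}\<close> (for \<open>a < b\<close>). Least upper bounds, greatest lower bounds, one-sided
  limits and definite descriptions are total operators in HOL, so the integrals are meaningful only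
  when the corresponding integrability predicate holds.
\<close>

text \<open>The points \<open>x 0, \<dots>, x n\<close> form a partition; values \<open>x i\<close> with \<open>i > n\<close> are irrelevant.\<close>

definition partition_on_interval :: "real \<Rightarrow> real \<Rightarrow> nat \<Rightarrow> (nat \<Rightarrow> real) \<Rightarrow> bool" where
  "partition_on_interval a b n x \<longleftrightarrow> x 0 = a \<and> x n = b \<and> (\<forall>i<n. x i < x (Suc i))"

definition bounded_fun :: "real \<Rightarrow> real \<Rightarrow> (real \<Rightarrow> real) \<Rightarrow> bool" where
  "bounded_fun a b f \<longleftrightarrow> bounded (f ` {a..b})"

definition bounded_variation :: "real \<Rightarrow> real \<Rightarrow> (real \<Rightarrow> real) \<Rightarrow> bool" where
  "bounded_variation a b \<alpha> \<longleftrightarrow>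
     (\<exists>V. \<forall>n x. partition_on_interval a b n x \<longrightarrow> (\<Sum>i<n. \<bar>\<alpha> (x (Suc i)) - \<alpha> (x i)\<bar>) \<le> V)"

text \<open>One-sided limits, with the convention \<open>\<alpha>(a-) = \<alpha>(a)\<close> and \<open>\<alpha>(b+) = \<alpha>(b)\<close>.\<close>

definition left_lim :: "real \<Rightarrow> (real \<Rightarrow> real) \<Rightarrow> real \<Rightarrow> real" where
  "left_lim a \<alpha> c = (if c = a then \<alpha> a else Lim (at_left c) \<alpha>)"

definition right_lim :: "real \<Rightarrow> (real \<Rightarrow> real) \<Rightarrow> real \<Rightarrow> real" where
  "right_lim b \<alpha> c = (if c = b then \<alpha> b else Lim (at_right c) \<alpha>)"

definition mu_open :: "real \<Rightarrow> real \<Rightarrow> (real \<Rightarrow> real) \<Rightarrow> real \<Rightarrow> real \<Rightarrow> real" where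
  "mu_open a b \<alpha> c d = left_lim a \<alpha> d - right_lim b \<alpha> c"

definition mu_point :: "real \<Rightarrow> real \<Rightarrow> (real \<Rightarrow> real) \<Rightarrow> real \<Rightarrow> real" where
  "mu_point a b \<alpha> c = right_lim b \<alpha> c - left_lim a \<alpha> c"

text \<open>The constant on the open interval \<open>(x i, x (i+1))\<close> is \<open>c i\<close>, so constants are indexed from 0.\<close>

definition step_repr ::
  "real \<Rightarrow> real \<Rightarrow> (real \<Rightarrow> real) \<Rightarrow> nat \<Rightarrow> (nat \<Rightarrow> real) \<Rightarrow> (nat \<Rightarrow> real) \<Rightarrow> bool" where
  "step_repr a b u n x c \<longleftrightarrow>
     partition_on_interval a b n x \<and> (\<forall>i<n. \<forall>t\<in>{x i<..<x (Suc i)}. u t = c i)"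

definition step_fun :: "real \<Rightarrow> real \<Rightarrow> (real \<Rightarrow> real) \<Rightarrow> bool" where
  "step_fun a b u \<longleftrightarrow> bounded_fun a b u \<and> (\<exists>n x c. step_repr a b u n x c)"

definition step_integral :: "real \<Rightarrow> real \<Rightarrow> (real \<Rightarrow> real) \<Rightarrow> (real \<Rightarrow> real) \<Rightarrow> real" where
  "step_integral a b \<alpha> u =
     (THE s. \<exists>n x c. step_repr a b u n x c \<and>
        s = (\<Sum>i\<le>n. u (x i) * mu_point a b \<alpha> (x i))
          + (\<Sum>i<n. c i * mu_open a b \<alpha> (x i) (x (Suc i))))"

definition lower_rds :: "real \<Rightarrow> real \<Rightarrow> (real \<Rightarrow> real) \<Rightarrow> (real \<Rightarrow> real) \<Rightarrow> real" where
  "lower_rds a b \<alpha> f =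
     Sup {step_integral a b \<alpha> v | v. step_fun a b v \<and> (\<forall>t\<in>{a..b}. v t \<le> f t)}"

definition upper_rds :: "real \<Rightarrow> real \<Rightarrow> (real \<Rightarrow> real) \<Rightarrow> (real \<Rightarrow> real) \<Rightarrow> real" where
  "upper_rds a b \<alpha> f =
     Inf {step_integral a b \<alpha> u | u. step_fun a b u \<and> (\<forall>t\<in>{a..b}. f t \<le> u t)}"

definition rds_integrable_incr :: "real \<Rightarrow> real \<Rightarrow> (real \<Rightarrow> real) \<Rightarrow> (real \<Rightarrow> real) \<Rightarrow> bool" where
  "rds_integrable_incr a b \<alpha> f \<longleftrightarrow>
     mono_on {a..b} \<alpha> \<and> bounded_fun a b f \<and> lower_rds a b \<alpha> f = upper_rds a b \<alpha> f"

definition rds_integral_incr :: "real \<Rightarrow> real \<Rightarrow> (real \<Rightarrow> real) \<Rightarrow> (real \<Rightarrow> real) \<Rightarrow> real" where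
  "rds_integral_incr a b \<alpha> f = lower_rds a b \<alpha> f"

text \<open>
  The decomposition \<open>\<alpha> = p - m\<close> into increasing functions may
  depend on the integrand; monotonicity of \<open>p\<close> and \<open>m\<close> is part of \<^const>\<open>rds_integrable_incr\<close>.
\<close>

definition rds_decomp ::
  "real \<Rightarrow> real \<Rightarrow> (real \<Rightarrow> real) \<Rightarrow> (real \<Rightarrow> real) \<Rightarrow> (real \<Rightarrow> real) \<Rightarrow> (real \<Rightarrow> real) \<Rightarrow> bool" where
  "rds_decomp a b \<alpha> f p m \<longleftrightarrow>
     (\<forall>t\<in>{a..b}. \<alpha> t = p t - m t) \<and> rds_integrable_incr a b p f \<and> rds_integrable_incr a b m f"

definition rds_integrable :: "real \<Rightarrow> real \<Rightarrow> (real \<Rightarrow> real) \<Rightarrow> (real \<Rightarrow> real) \<Rightarrow> bool" where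
  "rds_integrable a b \<alpha> f \<longleftrightarrow> bounded_variation a b \<alpha> \<and> (\<exists>p m. rds_decomp a b \<alpha> f p m)"

definition rds_integral :: "real \<Rightarrow> real \<Rightarrow> (real \<Rightarrow> real) \<Rightarrow> (real \<Rightarrow> real) \<Rightarrow> real" where
  "rds_integral a b \<alpha> f =
     (THE I. \<exists>p m. rds_decomp a b \<alpha> f p m \<and> I = rds_integral_incr a b p f - rds_integral_incr a b m f)"

end

theory Submission
  imports Defs
begin

text \<open>
  For increasing \<open>\<alpha>\<close> let \<open>\<mu>\<^sub>\<alpha>\<close> be the Lebesgue--Stieltjes measure of its right-continuous version. The
  integral of a step function is its Lebesgue integral, so a supremum of step functions below and an
  infimum of step functions above an integrable \<open>f\<close> give Borel functions \<open>v \<le> f \<le> u\<close> whose integrals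
  both equal that of \<open>f\<close>. If \<open>p - m = p' - m'\<close> then \<open>\<mu>\<^sub>p - \<mu>\<^sub>m = \<mu>\<^sub>p\<^sub>' - \<mu>\<^sub>m\<^sub>'\<close> as signed measures. Hence all
  integrals in the theorem are taken against \<open>\<mu>\<^sub>p - \<mu>\<^sub>m\<close> for the one decomposition attached to \<open>g\<close>. The set
  where some sandwich \<open>v \<le> f\<^sub>n \<le> u\<close> is strict carries no mass of this signed measure, and off that
  set \<open>v = f\<^sub>n\<close>, so dominated convergence applies to \<open>\<mu>\<^sub>p\<close> and \<open>\<mu>\<^sub>m\<close> separately.
\<close>

subsection \<open>The Stieltjes measure of an increasing function\<close>

text \<open>Extending \<open>\<alpha>\<close> by constants turns the conventions \<open>\<alpha>(a-) = \<alpha>(a)\<close> and \<open>\<alpha>(b+) = \<alpha>(b)\<close> into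
  genuine one-sided limits.\<close>

definition clamp_fun :: "real \<Rightarrow> real \<Rightarrow> (real \<Rightarrow> real) \<Rightarrow> real \<Rightarrow> real" where
  "clamp_fun a b \<alpha> x = \<alpha> (max a (min b x))"

text \<open>For increasing \<alpha> this infimum is the right-hand limit of the extension, so on
  [a,b] it is \<alpha>(x+) with the stated convention at b.\<close>

definition right_cont :: "real \<Rightarrow> real \<Rightarrow> (real \<Rightarrow> real) \<Rightarrow> real \<Rightarrow> real" where
  "right_cont a b \<alpha> x = (INF y\<in>{x<..}. clamp_fun a b \<alpha> y)"

definition rds_measure :: "real \<Rightarrow> real \<Rightarrow> (real \<Rightarrow> real) \<Rightarrow> real measure" where
  "rds_measure a b \<alpha> = interval_measure (right_cont a b \<alpha>)"

section \<open>One-sided limits of increasing functions\<close>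

lemma mono_tendsto_at_right:
  fixes f :: "real \<Rightarrow> real"
  assumes "mono f"
  shows "(f \<longlongrightarrow> (INF y\<in>{x<..}. f y)) (at_right x)"
proof (rule order_tendstoI)
  have bdd: "bdd_below (f ` {x<..})"
    by (intro bdd_belowI[of _ "f x"]) (auto intro!: monoD[OF assms])
  fix l assume "l < (INF y\<in>{x<..}. f y)"
  then have "l < f y" if "y > x" for y
    using cINF_lower[OF bdd, of y] that by simp
  then show "\<forall>\<^sub>F y in at_right x. l < f y"
    by (auto simp: eventually_at_filter)
next
  fix l assume "(INF y\<in>{x<..}. f y) < l"
  then obtain y where y: "y > x" "f y < l"
    using cInf_lessD[of "f ` {x<..}" l] by auto
  have "\<forall>\<^sub>F z in at_right x. z \<in> {x<..<y}"
    using y by (intro eventually_at_right_real)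
  then show "\<forall>\<^sub>F z in at_right x. f z < l"
    by (rule eventually_mono) (use y in \<open>meson assms greaterThanLessThan_iff le_less_trans less_imp_le monoD\<close>)
qed

lemma mono_tendsto_at_left:
  fixes f :: "real \<Rightarrow> real"
  assumes "mono f"
  shows "(f \<longlongrightarrow> (SUP y\<in>{..<x}. f y)) (at_left x)"
proof (rule order_tendstoI)
  have bdd: "bdd_above (f ` {..<x})"
    by (intro bdd_aboveI[of _ "f x"]) (auto intro!: monoD[OF assms])
  fix l assume "(SUP y\<in>{..<x}. f y) < l"
  then have "f y < l" if "y < x" for y
    using cSUP_upper[OF _ bdd, of y] that by simp
  then show "\<forall>\<^sub>F y in at_left x. f y < l"
    by (auto simp: eventually_at_filter)
next
  fix l assume "l < (SUP y\<in>{..<x}. f y)"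
  then obtain y where y: "y < x" "l < f y"
    using less_cSupD[of "f ` {..<x}" l] by auto
  have "\<forall>\<^sub>F z in at_left x. z \<in> {y<..<x}"
    using y by (intro eventually_at_left_real)
  then show "\<forall>\<^sub>F z in at_left x. l < f z"
    by (rule eventually_mono) (use y in \<open>meson assms greaterThanLessThan_iff less_le_trans less_imp_le monoD\<close>)
qed

context
  fixes a b :: real and \<alpha> :: "real \<Rightarrow> real"
  assumes ab: "a < b" and mono: "mono_on {a..b} \<alpha>"
begin

lemma mono_clamp_fun: "mono (clamp_fun a b \<alpha>)"
  unfolding clamp_fun_def using ab
  by (intro monoI mono_onD[OF mono]) auto

lemma right_cont_tendsto: "(clamp_fun a b \<alpha> \<longlongrightarrow> right_cont a b \<alpha> x) (at_right x)"
  unfolding right_cont_def by (rule mono_tendsto_at_right[OF mono_clamp_fun])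

lemma bdd_below_clamp: "bdd_below (clamp_fun a b \<alpha> ` {x<..})"
  by (intro bdd_belowI[of _ "clamp_fun a b \<alpha> x"]) (auto intro!: monoD[OF mono_clamp_fun])

text \<open>Together with the next lemma this interleaves the two functions: for x < y the value of
  \<open>right_cont\<close> at x lies between the values of \<open>clamp_fun\<close> at x and at y.
  Monotonicity, boundary values and left limits of \<open>right_cont\<close> all rest on
  this.\<close>

lemma clamp_le_right_cont: "clamp_fun a b \<alpha> x \<le> right_cont a b \<alpha> x"
  unfolding right_cont_def
  by (intro cINF_greatest) (auto intro!: monoD[OF mono_clamp_fun])

lemma right_cont_le_clamp: "x < y \<Longrightarrow> right_cont a b \<alpha> x \<le> clamp_fun a b \<alpha> y"
  unfolding right_cont_def by (intro cINF_lower bdd_below_clamp) auto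

lemma mono_right_cont: "x \<le> y \<Longrightarrow> right_cont a b \<alpha> x \<le> right_cont a b \<alpha> y"
  using right_cont_le_clamp[of x y] clamp_le_right_cont[of y] by (cases "x = y") auto

lemma continuous_right_cont: "continuous (at_right x) (right_cont a b \<alpha>)"
proof -
  have "(right_cont a b \<alpha> \<longlongrightarrow> (INF y\<in>{x<..}. right_cont a b \<alpha> y)) (at_right x)"
    by (rule mono_tendsto_at_right) (simp add: monoI mono_right_cont)
  moreover have "(INF y\<in>{x<..}. right_cont a b \<alpha> y) = right_cont a b \<alpha> x"
  proof (rule antisym)
    have bdd: "bdd_below (right_cont a b \<alpha> ` {x<..})"
      by (intro bdd_belowI[of _ "right_cont a b \<alpha> x"]) (auto intro: mono_right_cont)
    show "(INF y\<in>{x<..}. right_cont a b \<alpha> y) \<le> right_cont a b \<alpha> x"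
    proof (subst (2) right_cont_def, rule cINF_greatest)
      fix y assume "y \<in> {x<..}"
      \<comment> \<open>A point z strictly between x and y has \<open>right_cont\<close> value at
        most the extension at y, so taking the right limit a second time gives nothing
        larger.\<close>
      then obtain z where "x < z" "z < y" using dense by auto
      then show "(INF y\<in>{x<..}. right_cont a b \<alpha> y) \<le> clamp_fun a b \<alpha> y"
        using cINF_lower[OF bdd, of z] right_cont_le_clamp[of z y] by auto
    qed simp
    show "right_cont a b \<alpha> x \<le> (INF y\<in>{x<..}. right_cont a b \<alpha> y)"
      by (rule cINF_greatest) (auto intro: mono_right_cont)
  qed
  ultimately show ?thesis by (simp add: continuous_within)
qed

section \<open>Masses of intervals and points\<close>

lemma sets_rds_measure: "sets (rds_measure a b \<alpha>) = sets borel"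
  by (simp add: rds_measure_def)

lemma space_rds_measure: "space (rds_measure a b \<alpha>) = UNIV"
  by (simp add: rds_measure_def)

lemma emeasure_rds_Ioc:
  "x \<le> y \<Longrightarrow> emeasure (rds_measure a b \<alpha>) {x<..y} = ennreal (right_cont a b \<alpha> y - right_cont a b \<alpha> x)"
  unfolding rds_measure_def
  by (rule emeasure_interval_measure_Ioc) (auto intro: mono_right_cont continuous_right_cont)

text \<open>The inequality is strict here but not at b: at a itself the value is already
  \<alpha>(a+), and the jump from \<alpha>(a) to it becomes the atom at a.\<close>

lemma right_cont_below: "x < a \<Longrightarrow> right_cont a b \<alpha> x = \<alpha> a"
  using right_cont_le_clamp[of x a] clamp_le_right_cont[of x] ab
  by (auto simp: clamp_fun_def)

lemma right_cont_above: "b \<le> x \<Longrightarrow> right_cont a b \<alpha> x = \<alpha> b"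
  using right_cont_le_clamp[of x "x+1"] clamp_le_right_cont[of x] ab
  by (auto simp: clamp_fun_def)

lemma right_lim_eq: "x \<in> {a..b} \<Longrightarrow> right_lim b \<alpha> x = right_cont a b \<alpha> x"
proof (cases "x = b")
  case False
  assume x: "x \<in> {a..b}"
  have "\<forall>\<^sub>F z in at_right x. z \<in> {x<..<b}"
    using x False by (intro eventually_at_right_real) auto
  then have "\<forall>\<^sub>F z in at_right x. clamp_fun a b \<alpha> z = \<alpha> z"
    by eventually_elim (use x in \<open>auto simp: clamp_fun_def min_def max_def\<close>)
  with right_cont_tendsto[of x] have "(\<alpha> \<longlongrightarrow> right_cont a b \<alpha> x) (at_right x)"
    by (rule Lim_transform_eventually)
  then show ?thesis using False
    by (simp add: right_lim_def tendsto_Lim)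
qed (simp add: right_lim_def right_cont_above)

text \<open>Right-continuous modification keeps left limits: to the left of x the modified function
  lies between the extension and the supremum to which the extension converges. At x = a that
  supremum is \<alpha>(a), because the extension is constant to the left of a.\<close>

lemma right_cont_tendsto_left_lim:
  assumes x: "x \<in> {a..b}"
  shows "(right_cont a b \<alpha> \<longlongrightarrow> left_lim a \<alpha> x) (at_left x)"
proof -
  have "left_lim a \<alpha> x = (SUP y\<in>{..<x}. clamp_fun a b \<alpha> y)"
  proof (cases "x = a")
    case True
    then have "clamp_fun a b \<alpha> ` {..<x} = {\<alpha> a}"
      using ab by (force simp: clamp_fun_def image_iff intro: exI[of _ "a - 1"])
    then show ?thesis using True by (simp add: left_lim_def)
  next
    case False
    have "\<forall>\<^sub>F z in at_left x. z \<in> {a<..<x}"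
      using x False by (intro eventually_at_left_real) auto
    then have "\<forall>\<^sub>F z in at_left x. clamp_fun a b \<alpha> z = \<alpha> z"
      by eventually_elim (use x in \<open>auto simp: clamp_fun_def min_def max_def\<close>)
    with mono_tendsto_at_left[OF mono_clamp_fun, of x]
    have "(\<alpha> \<longlongrightarrow> (SUP y\<in>{..<x}. clamp_fun a b \<alpha> y)) (at_left x)"
      by (rule Lim_transform_eventually)
    then show ?thesis using False
      by (simp add: left_lim_def tendsto_Lim)
  qed
  moreover have "(right_cont a b \<alpha> \<longlongrightarrow> (SUP y\<in>{..<x}. clamp_fun a b \<alpha> y)) (at_left x)"
  proof (rule tendsto_sandwich)
    show "(clamp_fun a b \<alpha> \<longlongrightarrow> (SUP y\<in>{..<x}. clamp_fun a b \<alpha> y)) (at_left x)"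
      by (rule mono_tendsto_at_left[OF mono_clamp_fun])
    show "\<forall>\<^sub>F z in at_left x. clamp_fun a b \<alpha> z \<le> right_cont a b \<alpha> z"
      by (simp add: clamp_le_right_cont)
    have bdd: "bdd_above (clamp_fun a b \<alpha> ` {..<x})"
      by (intro bdd_aboveI[of _ "clamp_fun a b \<alpha> x"]) (auto intro!: monoD[OF mono_clamp_fun])
    have "right_cont a b \<alpha> z \<le> (SUP y\<in>{..<x}. clamp_fun a b \<alpha> y)" if z: "z < x" for z
    proof -
      obtain w where "z < w" "w < x" using dense z by auto
      then show ?thesis
        using right_cont_le_clamp[of z w] cSUP_upper[OF _ bdd, of w] by simp
    qed
    then show "\<forall>\<^sub>F z in at_left x. right_cont a b \<alpha> z \<le> (SUP y\<in>{..<x}. clamp_fun a b \<alpha> y)"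
      by (auto simp: eventually_at_filter)
  qed auto
  ultimately show ?thesis by simp
qed

lemma emeasure_rds_UNIV: "emeasure (rds_measure a b \<alpha>) UNIV = ennreal (\<alpha> b - \<alpha> a)"
proof -
  \<comment> \<open>Each of these intervals starts strictly below a and reaches b, so each already
    carries the full mass.\<close>
  have "(\<lambda>k. emeasure (rds_measure a b \<alpha>) {a - 1 - real k<..b + real k}) \<longlonglongrightarrow>
      emeasure (rds_measure a b \<alpha>) (\<Union>k. {a - 1 - real k<..b + real k})"
    by (rule Lim_emeasure_incseq) (auto simp: sets_rds_measure incseq_def)
  moreover have "UNIV = (\<Union>k. {a - 1 - real k<..b + real k})"
  proof (rule UNIV_eq_I)
    fix x
    obtain k where "\<bar>x\<bar> + \<bar>a\<bar> + \<bar>b\<bar> < real k" using reals_Archimedean2 by blast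
    then show "x \<in> (\<Union>k. {a - 1 - real k<..b + real k})"
      by (intro UN_I[of k]) auto
  qed
  moreover have "emeasure (rds_measure a b \<alpha>) {a - 1 - real k<..b + real k} = ennreal (\<alpha> b - \<alpha> a)" for k
    using ab by (subst emeasure_rds_Ioc) (auto simp: right_cont_above right_cont_below)
  ultimately show ?thesis
    by (simp add: LIMSEQ_const_iff)
qed

lemma finite_rds_measure: "finite_measure (rds_measure a b \<alpha>)"
  by (rule finite_measureI) (use emeasure_rds_UNIV in \<open>simp add: rds_measure_def\<close>)

interpretation finite_measure "rds_measure a b \<alpha>" by (rule finite_rds_measure)

lemma measure_rds_Ioc:
  "x \<le> y \<Longrightarrow> measure (rds_measure a b \<alpha>) {x<..y} = right_cont a b \<alpha> y - right_cont a b \<alpha> x"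
  using mono_right_cont[of x y] by (simp add: measure_def emeasure_rds_Ioc)

text \<open>Exhaustion from inside by half-open intervals. The left endpoint may lie below a, which
  the computation of the point masses uses.\<close>

lemma measure_rds_Ioo:
  assumes "x < y" "y \<in> {a..b}"
  shows "measure (rds_measure a b \<alpha>) {x<..<y} = left_lim a \<alpha> y - right_cont a b \<alpha> x"
proof -
  \<comment> \<open>These points start at the midpoint of x and y and increase to y without reaching
    it.\<close>
  define Y where "Y k = y - (y - x) / real (Suc (Suc k))" for k
  have Y: "x \<le> Y k" "Y k < y" for k
    using assms by (auto simp: Y_def field_simps intro!: add_mono mult_right_mono)
  have Yl: "Y \<longlonglongrightarrow> y"
  proof -
    have "(\<lambda>k. y - (y - x) / real (Suc (Suc k))) \<longlonglongrightarrow> y - 0"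
      using LIMSEQ_Suc[OF LIMSEQ_Suc[OF lim_const_over_n[of "y - x"]]] by (intro tendsto_diff) auto
    then show ?thesis by (simp add: Y_def[abs_def])
  qed
  have inc: "incseq Y"
    unfolding Y_def incseq_def using assms by (auto intro!: divide_left_mono)
  have "(\<lambda>k. measure (rds_measure a b \<alpha>) {x<..Y k}) \<longlonglongrightarrow> measure (rds_measure a b \<alpha>) (\<Union>k. {x<..Y k})"
    by (intro finite_Lim_measure_incseq)
      (auto simp: sets_rds_measure intro!: monoI intro: order_trans[OF _ incseqD[OF inc]])
  moreover have "(\<Union>k. {x<..Y k}) = {x<..<y}"
  proof safe
    fix z assume z: "z \<in> {x<..<y}"
    then have "\<forall>\<^sub>F k in sequentially. z < Y k" using order_tendstoD(1)[OF Yl] by auto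
    then obtain k where "z < Y k" by (auto dest: eventually_happens)
    then show "z \<in> (\<Union>k. {x<..Y k})" using z by (auto intro!: exI[of _ k])
  qed (use Y(2) in \<open>auto intro: le_less_trans\<close>)
  moreover have "(\<lambda>k. measure (rds_measure a b \<alpha>) {x<..Y k}) \<longlonglongrightarrow> left_lim a \<alpha> y - right_cont a b \<alpha> x"
  proof -
    have "filterlim Y (at_left y) sequentially"
      using Yl Y by (auto simp: filterlim_at less_imp_neq)
    then have "(\<lambda>k. right_cont a b \<alpha> (Y k)) \<longlonglongrightarrow> left_lim a \<alpha> y"
      using filterlim_compose[OF right_cont_tendsto_left_lim[OF assms(2)]] by blast
    then show ?thesis using Y by (simp add: measure_rds_Ioc tendsto_intros)
  qed
  ultimately show ?thesis using LIMSEQ_unique by metis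
qed

lemma measure_rds_open: "x < y \<Longrightarrow> x \<in> {a..b} \<Longrightarrow> y \<in> {a..b} \<Longrightarrow>
    measure (rds_measure a b \<alpha>) {x<..<y} = mu_open a b \<alpha> x y"
  by (simp add: measure_rds_Ioo mu_open_def right_lim_eq)

lemma measure_rds_point:
  assumes "x \<in> {a..b}"
  shows "measure (rds_measure a b \<alpha>) {x} = mu_point a b \<alpha> x"
proof -
  \<comment> \<open>The atom is the difference between the half-open and the open interval ending at
    x; the contribution of the auxiliary endpoint x - 1 cancels.\<close>
  have "measure (rds_measure a b \<alpha>) ({x-1<..<x} \<union> {x}) =
      measure (rds_measure a b \<alpha>) {x-1<..<x} + measure (rds_measure a b \<alpha>) {x}"
    by (rule finite_measure_Union) (auto simp: sets_rds_measure)
  also have "{x-1<..<x} \<union> {x} = {x-1<..x}" by auto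
  finally show ?thesis using assms
    by (simp add: measure_rds_Ioc measure_rds_Ioo mu_point_def right_lim_eq)
qed

end

subsection \<open>Pairs of measures with the same sum\<close>

text \<open>An equality of differences of measures, rearranged into sums to avoid signed measures.
  Half-open intervals form an intersection-stable generator, and the equation passes to complements
  and disjoint unions because all measures are finite. The whole line is no such interval; its
  equation feeds the complement case.\<close>

lemma measure_add_eqI:
  fixes M1 M2 M3 M4 :: "real measure"
  assumes fin: "finite_measure M1" "finite_measure M2" "finite_measure M3" "finite_measure M4"
    and sets: "sets M1 = sets borel" "sets M2 = sets borel" "sets M3 = sets borel" "sets M4 = sets borel"
    and Ioc: "\<And>x y. x \<le> y \<Longrightarrow> measure M1 {x<..y} + measure M2 {x<..y} = measure M3 {x<..y} + measure M4 {x<..y}"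
    and UNIV: "measure M1 UNIV + measure M2 UNIV = measure M3 UNIV + measure M4 UNIV"
    and A: "A \<in> sets borel"
  shows "measure M1 A + measure M2 A = measure M3 A + measure M4 A"
proof -
  let ?G = "range (\<lambda>(x, y). {x<..y::real})"
  have space: "space M1 = UNIV" "space M2 = UNIV" "space M3 = UNIV" "space M4 = UNIV"
    using sets[THEN sets_eq_imp_space_eq] by simp_all
  have G: "sigma_sets UNIV ?G = sets borel"
    by (subst borel_sigma_sets_Ioc) (simp add: sets_measure_of)
  have stable: "Int_stable ?G"
    by (rule Int_stableI) (auto simp: image_iff Int_greaterThanAtMost, blast)
  have closed: "?G \<subseteq> Pow UNIV" by simp
  have "A \<in> sigma_sets UNIV ?G" using A G by simp
  with stable closed show ?thesis
  proof (induction rule: sigma_sets_induct_disjoint)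
    case (basic B)
    then obtain x y where B: "B = {x<..y}" by auto
    show ?case unfolding B using Ioc[of x y] by (cases "x \<le> y") auto
  next
    case (compl B)
    then have "B \<in> sets borel" by (simp add: G)
    then show ?case using compl.IH UNIV
      using finite_measure.finite_measure_compl[OF fin(1), of B] finite_measure.finite_measure_compl[OF fin(2), of B]
        finite_measure.finite_measure_compl[OF fin(3), of B] finite_measure.finite_measure_compl[OF fin(4), of B]
      by (simp add: sets space)
  next
    case (union B)
    have r: "range B \<subseteq> sets borel" using union by (simp add: G)
    have "(\<lambda>i. measure M1 (B i) + measure M2 (B i)) sums (measure M1 (\<Union>i. B i) + measure M2 (\<Union>i. B i))"
      using union r sets by (intro sums_add finite_measure.finite_measure_UNION fin) auto
    moreover have "(\<lambda>i. measure M3 (B i) + measure M4 (B i)) sums (measure M3 (\<Union>i. B i) + measure M4 (\<Union>i. B i))"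
      using union r sets by (intro sums_add finite_measure.finite_measure_UNION fin) auto
    ultimately show ?case by (simp add: union.IH sums_unique2)
  qed auto
qed

lemma integrable_bounded_finite_measure:
  fixes v :: "'a \<Rightarrow> real"
  assumes "finite_measure M" "v \<in> borel_measurable M" "\<And>x. \<bar>v x\<bar> \<le> K"
  shows "integrable M v"
  using assms by (intro finite_measure.integrable_const_bound[of M v K]) auto

text \<open>The sum form survives each step of the standard induction on nonnegative measurable
  functions: scaling by distributivity, and limits because suprema of increasing sequences
  add.\<close>

lemma nn_integral_add_eqI:
  assumes sets: "sets M1 = sets M" "sets M2 = sets M" "sets M3 = sets M" "sets M4 = sets M"
    and eq: "\<And>A. A \<in> sets M \<Longrightarrow> emeasure M1 A + emeasure M2 A = emeasure M3 A + emeasure M4 A"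
    and h: "h \<in> borel_measurable M"
  shows "(\<integral>\<^sup>+x. h x \<partial>M1) + (\<integral>\<^sup>+x. h x \<partial>M2) = (\<integral>\<^sup>+x. h x \<partial>M3) + (\<integral>\<^sup>+x. h x \<partial>M4)"
proof -
  note [measurable_cong] = sets
  note space = sets[THEN sets_eq_imp_space_eq]
  show ?thesis using h
  proof (induction rule: borel_measurable_induct)
    case (cong f g)
    have "(\<integral>\<^sup>+x. f x \<partial>N) = (\<integral>\<^sup>+x. g x \<partial>N)" if "space N = space M" for N
      using cong that by (intro nn_integral_cong) auto
    then show ?case using cong space by simp
  next
    case (set A)
    then show ?case using eq[of A] sets by simp
  next
    case (mult u c)
    have [measurable]: "u \<in> borel_measurable M" by fact
    have "(\<integral>\<^sup>+x. c * u x \<partial>N) = c * (\<integral>\<^sup>+x. u x \<partial>N)" if [measurable_cong]: "sets N = sets M" for N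
      by (rule nn_integral_cmult) measurable
    then show ?case using mult.IH by (simp add: sets flip: distrib_left)
  next
    case (add u v)
    have [measurable]: "u \<in> borel_measurable M" "v \<in> borel_measurable M" by fact+
    have *: "(\<integral>\<^sup>+x. v x + u x \<partial>N) = (\<integral>\<^sup>+x. v x \<partial>N) + (\<integral>\<^sup>+x. u x \<partial>N)" if [measurable_cong]: "sets N = sets M" for N
      by (rule nn_integral_add) measurable
    have "(\<integral>\<^sup>+x. v x + u x \<partial>M1) + (\<integral>\<^sup>+x. v x + u x \<partial>M2) =
      ((\<integral>\<^sup>+x. v x \<partial>M1) + (\<integral>\<^sup>+x. v x \<partial>M2)) + ((\<integral>\<^sup>+x. u x \<partial>M1) + (\<integral>\<^sup>+x. u x \<partial>M2))"
      by (simp only: * sets) (simp only: add_ac)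
    also have "\<dots> = (\<integral>\<^sup>+x. v x + u x \<partial>M3) + (\<integral>\<^sup>+x. v x + u x \<partial>M4)"
      unfolding add.IH by (simp only: * sets) (simp only: add_ac)
    finally show ?case .
  next
    case (seq U)
    have [measurable]: "U i \<in> borel_measurable M" for i by fact
    have *: "(\<integral>\<^sup>+x. (SUP i. U i x) \<partial>N) = (SUP i. \<integral>\<^sup>+x. U i x \<partial>N)" if [measurable_cong]: "sets N = sets M" for N
      using seq by (intro nn_integral_monotone_convergence_SUP) auto
    have inc: "incseq (\<lambda>i. \<integral>\<^sup>+x. U i x \<partial>N)" for N
      using \<open>incseq U\<close> by (auto simp: incseq_def le_fun_def intro!: nn_integral_mono)
    show ?case
      unfolding SUP_apply by (simp only: * sets seq.IH flip: ennreal_SUP_add[OF inc inc])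
  qed
qed

text \<open>Adding K makes the integrand nonnegative and reduces to the previous lemma; the shifts
  cancel because the total masses satisfy the same equation.\<close>

lemma integral_add_eqI:
  fixes v :: "'a \<Rightarrow> real"
  assumes fin: "finite_measure M1" "finite_measure M2" "finite_measure M3" "finite_measure M4"
    and sets: "sets M1 = sets M" "sets M2 = sets M" "sets M3 = sets M" "sets M4 = sets M"
    and eq: "\<And>A. A \<in> sets M \<Longrightarrow> measure M1 A + measure M2 A = measure M3 A + measure M4 A"
    and v[measurable]: "v \<in> borel_measurable M" and K: "\<And>x. \<bar>v x\<bar> \<le> K"
  shows "(LINT x|M1. v x) + (LINT x|M2. v x) = (LINT x|M3. v x) + (LINT x|M4. v x)"
proof -
  note [measurable_cong] = sets
  have nn: "0 \<le> v x + K" for x using K[of x] by linarith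
  have shift: "(\<integral>\<^sup>+x. ennreal (v x + K) \<partial>N) = ennreal ((LINT x|N. v x) + K * measure N (space M))"
    and pos: "0 \<le> (LINT x|N. v x) + K * measure N (space M)"
    if N: "finite_measure N" and [measurable_cong]: "sets N = sets M" for N
  proof -
    interpret finite_measure N by fact
    have i: "integrable N v"
      using K by (intro integrable_bounded_finite_measure N) auto
    have s: "space N = space M" using sets_eq_imp_space_eq[OF that(2)] .
    have e: "(LINT x|N. v x + K) = (LINT x|N. v x) + K * measure N (space M)"
      using i by (simp add: s)
    show "(\<integral>\<^sup>+x. ennreal (v x + K) \<partial>N) = ennreal ((LINT x|N. v x) + K * measure N (space M))"
      using i nn by (subst nn_integral_eq_integral) (auto simp: e s)
    have "0 \<le> (LINT x|N. v x + K)" using nn by simp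
    then show "0 \<le> (LINT x|N. v x) + K * measure N (space M)" by (simp add: e)
  qed
  have eq': "emeasure M1 A + emeasure M2 A = emeasure M3 A + emeasure M4 A" if "A \<in> sets M" for A
    using eq[OF that] by (simp add: finite_measure.emeasure_eq_measure fin flip: ennreal_plus)
  have "ennreal (((LINT x|M1. v x) + K * measure M1 (space M)) + ((LINT x|M2. v x) + K * measure M2 (space M)))
      = ennreal (((LINT x|M3. v x) + K * measure M3 (space M)) + ((LINT x|M4. v x) + K * measure M4 (space M)))"
    using nn_integral_add_eqI[OF sets eq', of "\<lambda>x. ennreal (v x + K)"]
    by (simp add: shift pos fin sets)
  moreover have "K * measure M1 (space M) + K * measure M2 (space M) = K * measure M3 (space M) + K * measure M4 (space M)"
    using eq[of "space M"] by (simp flip: distrib_left)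
  \<comment> \<open>\<open>ennreal\<close> sends negative reals to 0, so returning to real numbers
    requires \<open>pos\<close> for all four measures.\<close>
  ultimately show ?thesis
    using pos[OF fin(1) sets(1)] pos[OF fin(2) sets(2)] pos[OF fin(3) sets(3)] pos[OF fin(4) sets(4)]
    by (subst (asm) ennreal_inj) (auto simp: algebra_simps)
qed

text \<open>Infima do not add in general, but right limits do. Clamping lands in [a,b], where p + m'
  = p' + m, so both sums have the same right limit.\<close>

lemma right_cont_add_eq:
  assumes ab: "a < b" and "mono_on {a..b} p" "mono_on {a..b} m" "mono_on {a..b} p'" "mono_on {a..b} m'"
    and eq: "\<And>t. t \<in> {a..b} \<Longrightarrow> p t - m t = p' t - m' t"
  shows "right_cont a b p x + right_cont a b m' x = right_cont a b p' x + right_cont a b m x"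
proof (rule tendsto_unique)
  have "(\<lambda>t. clamp_fun a b p t + clamp_fun a b m' t) = (\<lambda>t. clamp_fun a b p' t + clamp_fun a b m t)"
    using eq[of "max a (min b t)" for t] ab by (auto simp: clamp_fun_def fun_eq_iff algebra_simps)
  then show "((\<lambda>t. clamp_fun a b p t + clamp_fun a b m' t) \<longlongrightarrow> right_cont a b p' x + right_cont a b m x) (at_right x)"
    using assms by (auto intro!: tendsto_add right_cont_tendsto)
  show "((\<lambda>t. clamp_fun a b p t + clamp_fun a b m' t) \<longlongrightarrow> right_cont a b p x + right_cont a b m' x) (at_right x)"
    using assms by (auto intro!: tendsto_add right_cont_tendsto)
qed simp

lemma rds_measure_add_eq:
  assumes ab: "a < b" and mono: "mono_on {a..b} p" "mono_on {a..b} m" "mono_on {a..b} p'" "mono_on {a..b} m'"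
    and eq: "\<And>t. t \<in> {a..b} \<Longrightarrow> p t - m t = p' t - m' t"
    and A: "A \<in> sets borel"
  shows "measure (rds_measure a b p) A + measure (rds_measure a b m') A =
    measure (rds_measure a b p') A + measure (rds_measure a b m) A"
proof (rule measure_add_eqI[OF _ _ _ _ _ _ _ _ _ _ A])
  fix x y :: real assume "x \<le> y"
  then show "measure (rds_measure a b p) {x<..y} + measure (rds_measure a b m') {x<..y} =
    measure (rds_measure a b p') {x<..y} + measure (rds_measure a b m) {x<..y}"
    using right_cont_add_eq[OF ab mono eq, of x] right_cont_add_eq[OF ab mono eq, of y]
    by (simp add: measure_rds_Ioc[OF ab] mono)
next
  have le: "\<alpha> a \<le> \<alpha> b" if "mono_on {a..b} \<alpha>" for \<alpha> :: "real \<Rightarrow> real"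
    using ab by (intro mono_onD[OF that]) auto
  show "measure (rds_measure a b p) UNIV + measure (rds_measure a b m') UNIV =
    measure (rds_measure a b p') UNIV + measure (rds_measure a b m) UNIV"
    using eq[of a] eq[of b] ab by (simp add: measure_def emeasure_rds_UNIV[OF ab] mono le)
qed (simp_all add: finite_rds_measure[OF ab] sets_rds_measure[OF ab] mono)

text \<open>This moves the integral of a bounded Borel function from one decomposition of \<alpha>
  to any other.\<close>

lemma rds_integral_measure_add_eq:
  fixes v :: "real \<Rightarrow> real"
  assumes ab: "a < b" and mono: "mono_on {a..b} p" "mono_on {a..b} m" "mono_on {a..b} p'" "mono_on {a..b} m'"
    and eq: "\<And>t. t \<in> {a..b} \<Longrightarrow> p t - m t = p' t - m' t"
    and v: "v \<in> borel_measurable borel" "\<And>x. \<bar>v x\<bar> \<le> K"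
  shows "(LINT x|rds_measure a b p. v x) - (LINT x|rds_measure a b m. v x) =
    (LINT x|rds_measure a b p'. v x) - (LINT x|rds_measure a b m'. v x)"
proof -
  have "(LINT x|rds_measure a b p. v x) + (LINT x|rds_measure a b m'. v x) =
    (LINT x|rds_measure a b p'. v x) + (LINT x|rds_measure a b m. v x)"
    by (rule integral_add_eqI[OF _ _ _ _ _ _ _ _ rds_measure_add_eq[OF ab mono eq] v])
      (simp_all add: finite_rds_measure[OF ab] sets_rds_measure[OF ab] mono)
  then show ?thesis by simp
qed

subsection \<open>Step functions and Borel sandwiches\<close>

lemma partition_mono:
  assumes "partition_on_interval a b n x" "i \<le> j" "j \<le> n"
  shows "x i \<le> x j"
  using assms(2,3)
proof (induction rule: dec_induct)
  case (step k)
  then have "x k < x (Suc k)" using assms(1) by (simp add: partition_on_interval_def)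
  then show ?case using step by simp
qed simp

text \<open>Induction over the cells: passing from m to m + 1 adds one open cell and its right
  endpoint, disjointly. The indicator factor removes the uncontrolled values outside [a,b].\<close>

lemma step_repr_indicator:
  assumes r: "step_repr a b u n x c" and "m \<le> n"
  shows "indicator {a..x m} t * u t =
    (\<Sum>i\<le>m. u (x i) * indicator {x i} t) + (\<Sum>i<m. c i * indicator {x i<..<x (Suc i)} t)"
  using \<open>m \<le> n\<close>
proof (induction m)
  case 0
  then show ?case using r by (auto simp: step_repr_def partition_on_interval_def indicator_def)
next
  case (Suc m)
  have p: "partition_on_interval a b n x" using r by (simp add: step_repr_def)
  have "a \<le> x m" using partition_mono[OF p, of 0 m] p Suc.prems by (simp add: partition_on_interval_def)
  moreover have "x m < x (Suc m)" using p Suc.prems by (simp add: partition_on_interval_def)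
  moreover have "u t = c m" if "t \<in> {x m<..<x (Suc m)}"
    using r Suc.prems that by (simp add: step_repr_def)
  ultimately have "indicator {a..x (Suc m)} t * u t =
      indicator {a..x m} t * u t + u (x (Suc m)) * indicator {x (Suc m)} t + c m * indicator {x m<..<x (Suc m)} t"
    by (auto simp: indicator_def)
  then show ?case using Suc by simp
qed

lemma step_repr_measurable:
  fixes u :: "real \<Rightarrow> real"
  assumes "step_repr a b u n x c"
  shows "(\<lambda>t. indicator {a..b} t * u t) \<in> borel_measurable borel"
proof -
  have "x n = b" using assms by (simp add: step_repr_def partition_on_interval_def)
  with step_repr_indicator[OF assms order_refl]
  have "(\<lambda>t. indicator {a..b} t * u t) =
    (\<lambda>t. (\<Sum>i\<le>n. u (x i) * indicator {x i} t) + (\<Sum>i<n. c i * indicator {x i<..<x (Suc i)} t))"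
    by auto
  also have "\<dots> \<in> borel_measurable borel" by measurable
  finally show ?thesis .
qed

text \<open>Integrate the indicator expansion termwise. The right-hand side does not mention n, x or
  c, which yields the independence of the partition behind the definite description in
  \<open>step_integral\<close>.\<close>

lemma step_repr_integral:
  assumes ab: "a < b" and mono: "mono_on {a..b} \<alpha>" and r: "step_repr a b u n x c"
  shows "(\<Sum>i\<le>n. u (x i) * mu_point a b \<alpha> (x i)) + (\<Sum>i<n. c i * mu_open a b \<alpha> (x i) (x (Suc i)))
    = (LINT t|rds_measure a b \<alpha>. indicator {a..b} t * u t)"
proof -
  let ?M = "rds_measure a b \<alpha>"
  interpret finite_measure ?M by (rule finite_rds_measure[OF ab mono])
  note [measurable_cong] = sets_rds_measure[OF ab mono]
  have p: "partition_on_interval a b n x" using r by (simp add: step_repr_def)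
  have xn: "x n = b" "x 0 = a" using p by (simp_all add: partition_on_interval_def)
  have x: "x i \<in> {a..b}" if "i \<le> n" for i
    using partition_mono[OF p, of 0 i] partition_mono[OF p, of i n] that xn by simp
  have "(LINT t|?M. indicator {a..b} t * u t) =
    (LINT t|?M. (\<Sum>i\<le>n. u (x i) * indicator {x i} t) + (\<Sum>i<n. c i * indicator {x i<..<x (Suc i)} t))"
    using step_repr_indicator[OF r order_refl] xn by simp
  also have "\<dots> = (\<Sum>i\<le>n. u (x i) * measure ?M {x i}) + (\<Sum>i<n. c i * measure ?M {x i<..<x (Suc i)})"
  proof -
    have i: "integrable ?M (\<lambda>t. d * indicator B t)" "(LINT t|?M. d * indicator B t) = d * measure ?M B"
      if "B \<in> sets borel" for d :: real and B
    proof -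
      have "integrable ?M (indicat_real B)"
        using that by (intro integrable_real_indicator) (auto simp: sets_rds_measure[OF ab mono] less_top[symmetric])
      then show "integrable ?M (\<lambda>t. d * indicator B t)" "(LINT t|?M. d * indicator B t) = d * measure ?M B"
        by (simp_all add: space_rds_measure[OF ab mono])
    qed
    have "(LINT t|?M. (\<Sum>i\<in>I. d i * indicator (B i) t)) = (\<Sum>i\<in>I. d i * measure ?M (B i))"
      if "\<And>i. B i \<in> sets borel" for I :: "nat set" and d :: "nat \<Rightarrow> real" and B
      using i that by (subst Bochner_Integration.integral_sum) auto
    then show ?thesis
      by (subst Bochner_Integration.integral_add)
        (simp_all only: borel_singleton borel_open open_greaterThanLessThan sets.empty_sets i
          Bochner_Integration.integrable_sum)
  qed
  also have "\<dots> = (\<Sum>i\<le>n. u (x i) * mu_point a b \<alpha> (x i)) + (\<Sum>i<n. c i * mu_open a b \<alpha> (x i) (x (Suc i)))"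
    using x p by (intro arg_cong2[where f="(+)"] sum.cong refl)
      (auto simp: measure_rds_point[OF ab mono] measure_rds_open[OF ab mono] partition_on_interval_def)
  finally show ?thesis by simp
qed

lemma step_integral_eq:
  assumes ab: "a < b" and mono: "mono_on {a..b} \<alpha>" and u: "step_fun a b u"
  shows "step_integral a b \<alpha> u = (LINT t|rds_measure a b \<alpha>. indicator {a..b} t * u t)"
  unfolding step_integral_def
proof (rule the_equality)
  show "\<exists>n x c. step_repr a b u n x c \<and> (LINT t|rds_measure a b \<alpha>. indicator {a..b} t * u t) =
    (\<Sum>i\<le>n. u (x i) * mu_point a b \<alpha> (x i)) + (\<Sum>i<n. c i * mu_open a b \<alpha> (x i) (x (Suc i)))"
    using u unfolding step_fun_def by (auto dest: step_repr_integral[OF ab mono, symmetric])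
qed (auto simp: step_repr_integral[OF ab mono])

section \<open>Borel functions attaining the lower and upper integrals\<close>

lemma step_fun_const:
  assumes "a < b"
  shows "step_fun a b (\<lambda>_. c)"
proof -
  have "step_repr a b (\<lambda>_. c) 1 (\<lambda>i. if i = 0 then a else b) (\<lambda>_. c)"
    using assms by (simp add: step_repr_def partition_on_interval_def)
  then show ?thesis by (auto simp: step_fun_def bounded_fun_def image_constant_conv)
qed

lemma step_fun_uminus:
  assumes "step_fun a b u"
  shows "step_fun a b (\<lambda>t. - u t)"
proof -
  have "bounded ((\<lambda>t. - u t) ` {a..b})"
    using assms bounded_uminus[of "u ` {a..b}"] by (simp add: step_fun_def bounded_fun_def image_image)
  moreover obtain n x c where "step_repr a b u n x c" using assms by (auto simp: step_fun_def)
  then have "step_repr a b (\<lambda>t. - u t) n x (\<lambda>i. - c i)" by (simp add: step_repr_def)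
  ultimately show ?thesis by (auto simp: step_fun_def bounded_fun_def)
qed

lemma bounded_funE:
  assumes "bounded_fun a b f"
  obtains K where "0 \<le> K" "\<And>t. t \<in> {a..b} \<Longrightarrow> \<bar>f t\<bar> \<le> K"
proof -
  obtain K where "\<forall>t\<in>{a..b}. \<bar>f t\<bar> \<le> K"
    using assms by (auto simp: bounded_fun_def bounded_iff)
  then show ?thesis by (intro that[of "\<bar>K\<bar>"]) (auto intro: order_trans[OF _ abs_ge_self])
qed

text \<open>Take step functions below f whose integrals come within 1/(k+1) of the supremum. Their
  countable pointwise supremum is Borel, stays below f, and has an integral at least as large as
  each of theirs. The reverse bound comes later, from comparison with a majorant.\<close>

lemma lower_rds_minorant:
  assumes ab: "a < b" and mono: "mono_on {a..b} \<alpha>" and bf: "bounded_fun a b f"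
  obtains v K where "v \<in> borel_measurable borel" "\<And>t. \<bar>v t\<bar> \<le> K"
    "\<And>t. v t \<le> indicator {a..b} t * f t" "lower_rds a b \<alpha> f \<le> (LINT t|rds_measure a b \<alpha>. v t)"
proof -
  let ?M = "rds_measure a b \<alpha>"
  let ?S = "{step_integral a b \<alpha> v | v. step_fun a b v \<and> (\<forall>t\<in>{a..b}. v t \<le> f t)}"
  interpret finite_measure ?M by (rule finite_rds_measure[OF ab mono])
  note [measurable_cong] = sets_rds_measure[OF ab mono]
  obtain B where B: "0 \<le> B" "\<And>t. t \<in> {a..b} \<Longrightarrow> \<bar>f t\<bar> \<le> B" using bounded_funE[OF bf] by blast
  \<comment> \<open>A constant lower bound of f supplies a member of the set, so that elements close
    to its supremum can be chosen.\<close>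
  have "step_integral a b \<alpha> (\<lambda>_. - B) \<in> ?S"
    using step_fun_const[OF ab, of "-B"] B(2) by (force simp: abs_le_iff)
  then have ne: "?S \<noteq> {}" by blast
  have "\<exists>v. step_fun a b v \<and> (\<forall>t\<in>{a..b}. v t \<le> f t) \<and> lower_rds a b \<alpha> f - 1 / real (Suc k) < step_integral a b \<alpha> v" for k
  proof -
    have "lower_rds a b \<alpha> f - 1 / real (Suc k) < Sup ?S"
      by (simp add: lower_rds_def)
    from less_cSupE[OF this ne] show ?thesis by blast
  qed
  then obtain v where v: "\<And>k. step_fun a b (v k)" "\<And>k t. t \<in> {a..b} \<Longrightarrow> v k t \<le> f t"
    "\<And>k. lower_rds a b \<alpha> f - 1 / real (Suc k) < step_integral a b \<alpha> (v k)"
    by metis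
  define w where "w k t = indicator {a..b} t * v k t" for k t
  have w_meas [measurable]: "w k \<in> borel_measurable borel" for k
    using v(1)[of k] step_repr_measurable by (auto simp: step_fun_def w_def[abs_def])
  have w_le: "w k t \<le> indicator {a..b} t * f t" for k t
    using v(2) by (simp add: w_def indicator_def)
  have fB: "\<bar>indicator {a..b} t * f t\<bar> \<le> B" for t
    using B by (simp add: indicator_def)
  have w_int: "integrable ?M (w k)" for k
  proof -
    obtain K where "0 \<le> K" "\<And>t. t \<in> {a..b} \<Longrightarrow> \<bar>v k t\<bar> \<le> K"
      using v(1)[of k] bounded_funE by (metis step_fun_def)
    then have "\<bar>w k t\<bar> \<le> K" for t by (simp add: w_def indicator_def)
    then show ?thesis by (intro integrable_bounded_finite_measure[OF finite_measure_axioms]) auto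
  qed
  define V where "V t = (SUP k. w k t)" for t
  have bdd: "bdd_above (range (\<lambda>k. w k t))" for t
    using w_le by (intro bdd_aboveI) auto
  have V_meas [measurable]: "V \<in> borel_measurable borel"
    unfolding V_def[abs_def] by (rule borel_measurable_cSUP) (auto intro: bdd)
  have V_le: "V t \<le> indicator {a..b} t * f t" for t
    unfolding V_def by (intro cSUP_least) (auto intro: w_le)
  have w_V: "w k t \<le> V t" for k t
    unfolding V_def by (rule cSUP_upper[OF _ bdd]) simp
  obtain K where K: "0 \<le> K" "\<And>t. t \<in> {a..b} \<Longrightarrow> \<bar>v 0 t\<bar> \<le> K"
    using v(1)[of 0] bounded_funE by (metis step_fun_def)
  \<comment> \<open>Below, V is controlled by the first step function alone; above, by the bound of
    f.\<close>
  have V_bound: "\<bar>V t\<bar> \<le> K + B" for t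
  proof -
    have "\<bar>w 0 t\<bar> \<le> K" using K by (simp add: w_def indicator_def)
    then show ?thesis using V_le[of t] w_V[of 0 t] fB[of t] K B by linarith
  qed
  have "lower_rds a b \<alpha> f - 1 / real (Suc k) \<le> (LINT t|?M. V t)" for k
  proof -
    have "step_integral a b \<alpha> (v k) = (LINT t|?M. w k t)"
      using step_integral_eq[OF ab mono v(1)] by (simp add: w_def)
    also have "\<dots> \<le> (LINT t|?M. V t)"
      by (intro integral_mono w_int w_V integrable_bounded_finite_measure[OF finite_measure_axioms _ V_bound]) simp
    finally show ?thesis using v(3)[of k] by simp
  qed
  moreover have "(\<lambda>k. lower_rds a b \<alpha> f - 1 / real (Suc k)) \<longlonglongrightarrow> lower_rds a b \<alpha> f - 0"
    by (intro tendsto_diff tendsto_const LIMSEQ_Suc[OF lim_1_over_n])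
  ultimately have "lower_rds a b \<alpha> f \<le> (LINT t|?M. V t)"
    by (intro LIMSEQ_le_const2[where X="\<lambda>k. lower_rds a b \<alpha> f - 1 / real (Suc k)"]) auto
  then show ?thesis using that[OF V_meas V_bound V_le] by blast
qed

text \<open>Negation exchanges step functions above f with those below -f, and \<open>Inf\<close> on
  the reals is minus the \<open>Sup\<close> of the negated set. Majorants are thereby obtained from
  minorants.\<close>

lemma upper_rds_eq_lower:
  assumes ab: "a < b" and mono: "mono_on {a..b} \<alpha>"
  shows "upper_rds a b \<alpha> f = - lower_rds a b \<alpha> (\<lambda>t. - f t)"
proof -
  let ?S = "{step_integral a b \<alpha> u | u. step_fun a b u \<and> (\<forall>t\<in>{a..b}. f t \<le> u t)}"
  let ?T = "{step_integral a b \<alpha> v | v. step_fun a b v \<and> (\<forall>t\<in>{a..b}. v t \<le> - f t)}"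
  have neg: "step_integral a b \<alpha> (\<lambda>t. - u t) = - step_integral a b \<alpha> u" if "step_fun a b u" for u
    using step_fun_uminus[OF that] that by (simp add: step_integral_eq[OF ab mono])
  have "uminus ` ?S = ?T"
  proof (intro equalityI subsetI)
    fix s assume "s \<in> uminus ` ?S"
    then obtain u where u: "step_fun a b u" "\<forall>t\<in>{a..b}. f t \<le> u t" "s = - step_integral a b \<alpha> u" by auto
    then show "s \<in> ?T" using neg[OF u(1)] step_fun_uminus[OF u(1)] by (intro CollectI exI[of _ "\<lambda>t. - u t"]) auto
  next
    fix s assume "s \<in> ?T"
    then obtain u where u: "step_fun a b u" "\<forall>t\<in>{a..b}. u t \<le> - f t" "s = step_integral a b \<alpha> u" by auto
    have "- s \<in> ?S" using u neg[OF u(1)] step_fun_uminus[OF u(1)]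
      by (intro CollectI exI[of _ "\<lambda>t. - u t"]) (auto simp: le_minus_iff)
    then show "s \<in> uminus ` ?S" by (intro image_eqI[of _ _ "-s"]) auto
  qed
  then show ?thesis by (simp add: upper_rds_def lower_rds_def Inf_real_def)
qed

text \<open>Values outside \<open>[a,b]\<close> are junk, so \<open>f\<close> is replaced by 0 there.\<close>

definition borel_sandwich :: "real \<Rightarrow> real \<Rightarrow> (real \<Rightarrow> real) \<Rightarrow> (real \<Rightarrow> real) \<Rightarrow> (real \<Rightarrow> real) \<Rightarrow> bool" where
  "borel_sandwich a b f v u \<longleftrightarrow> v \<in> borel_measurable borel \<and> u \<in> borel_measurable borel \<and>
    (\<exists>K. \<forall>t. \<bar>v t\<bar> \<le> K \<and> \<bar>u t\<bar> \<le> K) \<and> (\<forall>t. v t \<le> indicator {a..b} t * f t \<and> indicator {a..b} t * f t \<le> u t)"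

text \<open>The tighter sandwich makes one pair of functions serve several measures at once.\<close>

lemma borel_sandwich_combine:
  assumes "borel_sandwich a b f v u" "borel_sandwich a b f v' u'"
  shows "borel_sandwich a b f (\<lambda>t. max (v t) (v' t)) (\<lambda>t. min (u t) (u' t))"
proof -
  obtain K K' where "\<And>t. \<bar>v t\<bar> \<le> K \<and> \<bar>u t\<bar> \<le> K" "\<And>t. \<bar>v' t\<bar> \<le> K' \<and> \<bar>u' t\<bar> \<le> K'"
    using assms unfolding borel_sandwich_def by metis
  then have "\<bar>max (v t) (v' t)\<bar> \<le> max K K' \<and> \<bar>min (u t) (u' t)\<bar> \<le> max K K'" for t
    by (smt (verit))
  with assms show ?thesis unfolding borel_sandwich_def by auto
qed

context
  fixes a b :: real and \<alpha> :: "real \<Rightarrow> real"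
  assumes ab: "a < b" and mono: "mono_on {a..b} \<alpha>"
begin

interpretation finite_measure "rds_measure a b \<alpha>" by (rule finite_rds_measure[OF ab mono])

lemma borel_sandwich_integrable:
  assumes "borel_sandwich a b f v u"
  shows "integrable (rds_measure a b \<alpha>) v" "integrable (rds_measure a b \<alpha>) u"
proof -
  note [measurable_cong] = sets_rds_measure[OF ab mono]
  obtain K where "\<And>t. \<bar>v t\<bar> \<le> K" "\<And>t. \<bar>u t\<bar> \<le> K"
    and [measurable]: "v \<in> borel_measurable borel" "u \<in> borel_measurable borel"
    using assms unfolding borel_sandwich_def by metis
  then show "integrable (rds_measure a b \<alpha>) v" "integrable (rds_measure a b \<alpha>) u"
    by (auto intro!: integrable_bounded_finite_measure[OF finite_measure_axioms])
qed

text \<open>The majorant is minus a minorant of -f. The chain lower \<le> integral of v \<le>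
  integral of the majorant \<le> upper closes up because the two ends are equal.\<close>

lemma rds_integrable_incr_sandwich:
  assumes f: "rds_integrable_incr a b \<alpha> f"
  obtains v u where "borel_sandwich a b f v u"
    "(LINT t|rds_measure a b \<alpha>. v t) = rds_integral_incr a b \<alpha> f"
    "(LINT t|rds_measure a b \<alpha>. u t) = rds_integral_incr a b \<alpha> f"
proof -
  let ?M = "rds_measure a b \<alpha>"
  have bf: "bounded_fun a b f" and eq: "upper_rds a b \<alpha> f = lower_rds a b \<alpha> f"
    using f by (simp_all add: rds_integrable_incr_def)
  have bf': "bounded_fun a b (\<lambda>t. - f t)"
    using bf bounded_uminus[of "f ` {a..b}"] by (simp add: bounded_fun_def image_image)
  obtain v K where v: "v \<in> borel_measurable borel" "\<And>t. \<bar>v t\<bar> \<le> K"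
    "\<And>t. v t \<le> indicator {a..b} t * f t" "lower_rds a b \<alpha> f \<le> (LINT t|?M. v t)"
    using lower_rds_minorant[OF ab mono bf] by blast
  obtain u K' where u: "u \<in> borel_measurable borel" "\<And>t. \<bar>u t\<bar> \<le> K'"
    "\<And>t. u t \<le> indicator {a..b} t * - f t" "lower_rds a b \<alpha> (\<lambda>t. - f t) \<le> (LINT t|?M. u t)"
    using lower_rds_minorant[OF ab mono bf'] by blast
  have s: "borel_sandwich a b f v (\<lambda>t. - u t)"
    unfolding borel_sandwich_def
  proof (intro conjI exI[of _ "max K K'"] allI)
    fix t show "indicator {a..b} t * f t \<le> - u t" using u(3)[of t] by simp
    show "\<bar>v t\<bar> \<le> max K K'" "\<bar>- u t\<bar> \<le> max K K'" using v(2)[of t] u(2)[of t] by auto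
  qed (use u(1) v in auto)
  have "(LINT t|?M. v t) \<le> (LINT t|?M. - u t)"
    using s by (intro integral_mono borel_sandwich_integrable[OF s])
      (auto simp: borel_sandwich_def intro: order_trans)
  moreover have "(LINT t|?M. - u t) \<le> lower_rds a b \<alpha> f"
    using u(4) eq upper_rds_eq_lower[OF ab mono, of f] by simp
  ultimately show ?thesis
    using v(4) by (intro that[OF s]) (simp_all add: rds_integral_incr_def)
qed

text \<open>The inner integrals are squeezed between the outer ones, so tightening an optimal
  sandwich keeps it optimal.\<close>

lemma borel_sandwich_refine:
  assumes s: "borel_sandwich a b f v u" and s': "borel_sandwich a b f v' u'"
    and le: "\<And>t. v t \<le> v' t" "\<And>t. u' t \<le> u t"
    and I: "(LINT t|rds_measure a b \<alpha>. v t) = I" "(LINT t|rds_measure a b \<alpha>. u t) = I"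
  shows "(LINT t|rds_measure a b \<alpha>. v' t) = I" "(LINT t|rds_measure a b \<alpha>. u' t) = I"
proof -
  let ?M = "rds_measure a b \<alpha>"
  have "(LINT t|?M. v t) \<le> (LINT t|?M. v' t)" "(LINT t|?M. u' t) \<le> (LINT t|?M. u t)"
    by (intro integral_mono borel_sandwich_integrable[OF s] borel_sandwich_integrable[OF s'] le)+
  moreover have "(LINT t|?M. v' t) \<le> (LINT t|?M. u' t)"
    using s' by (intro integral_mono borel_sandwich_integrable[OF s'])
      (auto simp: borel_sandwich_def intro: order_trans)
  ultimately show "(LINT t|rds_measure a b \<alpha>. v' t) = I" "(LINT t|rds_measure a b \<alpha>. u' t) = I"
    using I by linarith+
qed

text \<open>A nonnegative function with zero integral, here u - v, vanishes almost
  everywhere.\<close>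

lemma borel_sandwich_null:
  assumes s: "borel_sandwich a b f v u"
    and eq: "(LINT t|rds_measure a b \<alpha>. v t) = (LINT t|rds_measure a b \<alpha>. u t)"
    and B: "B \<in> sets borel" "B \<subseteq> {t. v t \<noteq> u t}"
  shows "measure (rds_measure a b \<alpha>) B = 0"
proof -
  let ?M = "rds_measure a b \<alpha>"
  note [measurable_cong] = sets_rds_measure[OF ab mono]
  have [measurable]: "v \<in> borel_measurable borel" "u \<in> borel_measurable borel"
    using s by (auto simp: borel_sandwich_def)
  note i = borel_sandwich_integrable[OF s]
  have "(LINT t|?M. u t - v t) = 0" using i eq by simp
  moreover have "0 \<le> u t - v t" for t
    using s by (auto simp: borel_sandwich_def intro: order_trans)
  ultimately have "AE t in ?M. u t - v t = 0"
    using i by (subst (asm) integral_nonneg_eq_0_iff_AE) auto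
  then have "AE t in ?M. t \<notin> B" by eventually_elim (use B in auto)
  then have "B \<in> null_sets ?M" using B by (subst AE_iff_null_sets) auto
  then show ?thesis by (simp add: null_sets_def measure_def)
qed

end

section \<open>Independence of the decomposition\<close>

lemma rds_decomp_sandwich:
  assumes ab: "a < b" and d: "rds_decomp a b \<alpha> f p m"
  obtains v u where "borel_sandwich a b f v u"
    "(LINT t|rds_measure a b p. v t) = rds_integral_incr a b p f"
    "(LINT t|rds_measure a b p. u t) = rds_integral_incr a b p f"
    "(LINT t|rds_measure a b m. v t) = rds_integral_incr a b m f"
    "(LINT t|rds_measure a b m. u t) = rds_integral_incr a b m f"
proof -
  have i: "rds_integrable_incr a b p f" "rds_integrable_incr a b m f"
    using d by (simp_all add: rds_decomp_def)
  then have mono: "mono_on {a..b} p" "mono_on {a..b} m" by (simp_all add: rds_integrable_incr_def)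
  obtain v u where s: "borel_sandwich a b f v u"
    "(LINT t|rds_measure a b p. v t) = rds_integral_incr a b p f"
    "(LINT t|rds_measure a b p. u t) = rds_integral_incr a b p f"
    using rds_integrable_incr_sandwich[OF ab mono(1) i(1)] by blast
  obtain v' u' where s': "borel_sandwich a b f v' u'"
    "(LINT t|rds_measure a b m. v' t) = rds_integral_incr a b m f"
    "(LINT t|rds_measure a b m. u' t) = rds_integral_incr a b m f"
    using rds_integrable_incr_sandwich[OF ab mono(2) i(2)] by blast
  \<comment> \<open>The combined pair refines the sandwich optimal for p and the one optimal for m,
    hence is optimal for both.\<close>
  note c = borel_sandwich_combine[OF s(1) s'(1)]
  show ?thesis
    by (rule that[OF c]; (rule borel_sandwich_refine[OF ab mono(1) s(1) c _ _ s(2,3)]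
      | rule borel_sandwich_refine[OF ab mono(2) s'(1) c _ _ s'(2,3)]); simp)
qed

lemma rds_decomp_mono:
  assumes "rds_decomp a b \<alpha> f p m"
  shows "mono_on {a..b} p" "mono_on {a..b} m"
  using assms by (simp_all add: rds_decomp_def rds_integrable_incr_def)

text \<open>Two decompositions give two sandwiches of f. Their combined minorant \<open>?w\<close>
  has the right integral against all four measures, and its integral against the difference of
  measures depends only on \<alpha>.\<close>

lemma rds_integral_eq:
  assumes ab: "a < b" and d: "rds_decomp a b \<alpha> f p m"
  shows "rds_integral a b \<alpha> f = rds_integral_incr a b p f - rds_integral_incr a b m f"
  unfolding rds_integral_def
proof (rule the_equality)
  show "\<exists>p' m'. rds_decomp a b \<alpha> f p' m' \<and>
    rds_integral_incr a b p f - rds_integral_incr a b m f = rds_integral_incr a b p' f - rds_integral_incr a b m' f"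
    using d by blast
next
  fix I assume "\<exists>p m. rds_decomp a b \<alpha> f p m \<and> I = rds_integral_incr a b p f - rds_integral_incr a b m f"
  then obtain p' m' where d': "rds_decomp a b \<alpha> f p' m'"
    and I: "I = rds_integral_incr a b p' f - rds_integral_incr a b m' f" by blast
  note mono = rds_decomp_mono[OF d] and mono' = rds_decomp_mono[OF d']
  obtain v u where s: "borel_sandwich a b f v u"
    "(LINT t|rds_measure a b p. v t) = rds_integral_incr a b p f"
    "(LINT t|rds_measure a b p. u t) = rds_integral_incr a b p f"
    "(LINT t|rds_measure a b m. v t) = rds_integral_incr a b m f"
    "(LINT t|rds_measure a b m. u t) = rds_integral_incr a b m f"
    using rds_decomp_sandwich[OF ab d] by blast
  obtain v' u' where s': "borel_sandwich a b f v' u'"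
    "(LINT t|rds_measure a b p'. v' t) = rds_integral_incr a b p' f"
    "(LINT t|rds_measure a b p'. u' t) = rds_integral_incr a b p' f"
    "(LINT t|rds_measure a b m'. v' t) = rds_integral_incr a b m' f"
    "(LINT t|rds_measure a b m'. u' t) = rds_integral_incr a b m' f"
    using rds_decomp_sandwich[OF ab d'] by blast
  let ?w = "\<lambda>t. max (v t) (v' t)"
  note c = borel_sandwich_combine[OF s(1) s'(1)]
  have w: "(LINT t|rds_measure a b p. ?w t) = rds_integral_incr a b p f"
    "(LINT t|rds_measure a b m. ?w t) = rds_integral_incr a b m f"
    "(LINT t|rds_measure a b p'. ?w t) = rds_integral_incr a b p' f"
    "(LINT t|rds_measure a b m'. ?w t) = rds_integral_incr a b m' f"
    using borel_sandwich_refine(1)[OF ab mono(1) s(1) c _ _ s(2,3)]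
      borel_sandwich_refine(1)[OF ab mono(2) s(1) c _ _ s(4,5)]
      borel_sandwich_refine(1)[OF ab mono'(1) s'(1) c _ _ s'(2,3)]
      borel_sandwich_refine(1)[OF ab mono'(2) s'(1) c _ _ s'(4,5)] by simp_all
  obtain K where K: "\<And>t. \<bar>?w t\<bar> \<le> K" "?w \<in> borel_measurable borel"
    using c unfolding borel_sandwich_def by blast
  have eq: "p t - m t = p' t - m' t" if "t \<in> {a..b}" for t
    using that d d' by (auto simp: rds_decomp_def)
  show "I = rds_integral_incr a b p f - rds_integral_incr a b m f"
    using rds_integral_measure_add_eq[OF ab mono mono' eq K(2) K(1)] unfolding w I by simp
qed

section \<open>Passage to the limit\<close>

lemma integral_eq_on_set:
  fixes h :: "'a \<Rightarrow> real"
  assumes sets: "sets M = sets N" and A: "A \<in> sets M"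
    and eq: "\<And>B. B \<in> sets M \<Longrightarrow> B \<subseteq> A \<Longrightarrow> emeasure M B = emeasure N B"
    and h: "h \<in> borel_measurable M"
  shows "(LINT x|M. indicator A x * h x) = (LINT x|N. indicator A x * h x)"
proof -
  note [measurable_cong] = sets
  note [measurable] = A h
  \<comment> \<open>Restricted to A the two measures become one: both give a set B the mass of its
    intersection with A.\<close>
  have "density M (indicator A) = density N (indicator A)"
  proof (rule measure_eqI)
    fix B assume "B \<in> sets (density M (indicator A))"
    then have [measurable]: "B \<in> sets M" by simp
    show "emeasure (density M (indicator A)) B = emeasure (density N (indicator A)) B"
      using eq[of "A \<inter> B"] by (simp add: emeasure_restricted flip: sets)
  qed (simp add: sets)
  moreover have "(LINT x|density L (indicator A). h x) = (LINT x|L. indicator A x * h x)"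
    if [measurable_cong]: "sets L = sets M" for L
    using integral_density[of h L "indicator A"] by (simp add: ennreal_indicator)
  ultimately show ?thesis using sets by metis
qed

theorem theorem1p6:
  fixes a b :: real and \<alpha> :: "real \<Rightarrow> real"
    and f :: "nat \<Rightarrow> real \<Rightarrow> real" and g :: "real \<Rightarrow> real"
  assumes "a < b"
    and "bounded_variation a b \<alpha>"
    and "\<exists>M. \<forall>n. \<forall>x\<in>{a..b}. \<bar>f n x\<bar> \<le> M"
    and "\<And>n. rds_integrable a b \<alpha> (f n)"
    and "\<And>x. x \<in> {a..b} \<Longrightarrow> (\<lambda>n. f n x) \<longlonglongrightarrow> g x"
    and "rds_integrable a b \<alpha> g"
  shows "(\<lambda>n. rds_integral a b \<alpha> (f n)) \<longlonglongrightarrow> rds_integral a b \<alpha> g"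
proof -
  note ab = \<open>a < b\<close>
  \<comment> \<open>The limit g gets index 0 and \<open>f n\<close> index n + 1, so that one
    countable family holds all decompositions and sandwiches; index 0 provides the reference
    measures \<open>?P\<close> and \<open>?N\<close>.\<close>
  define F where "F = case_nat g f"
  have F_simps: "F 0 = g" "F (Suc n) = f n" for n by (simp_all add: F_def)
  have "\<exists>p m. rds_decomp a b \<alpha> (F k) p m" for k
    using assms(4,6) by (cases k) (auto simp: F_simps rds_integrable_def)
  then obtain p m where d: "\<And>k. rds_decomp a b \<alpha> (F k) (p k) (m k)" by metis
  note mono = rds_decomp_mono[OF d]
  have "\<exists>v u. borel_sandwich a b (F k) v u \<and>
    (LINT t|rds_measure a b (p k). v t) = rds_integral_incr a b (p k) (F k) \<and>
    (LINT t|rds_measure a b (p k). u t) = rds_integral_incr a b (p k) (F k) \<and>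
    (LINT t|rds_measure a b (m k). v t) = rds_integral_incr a b (m k) (F k) \<and>
    (LINT t|rds_measure a b (m k). u t) = rds_integral_incr a b (m k) (F k)" for k
    using rds_decomp_sandwich[OF ab d[of k]] by blast
  then obtain v u where s: "\<And>k. borel_sandwich a b (F k) (v k) (u k)"
    and vp: "\<And>k. (LINT t|rds_measure a b (p k). v k t) = rds_integral_incr a b (p k) (F k)"
    and up: "\<And>k. (LINT t|rds_measure a b (p k). u k t) = rds_integral_incr a b (p k) (F k)"
    and vm: "\<And>k. (LINT t|rds_measure a b (m k). v k t) = rds_integral_incr a b (m k) (F k)"
    and um: "\<And>k. (LINT t|rds_measure a b (m k). u k t) = rds_integral_incr a b (m k) (F k)"
    by metis
  let ?P = "rds_measure a b (p 0)" and ?N = "rds_measure a b (m 0)"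
  have sets [measurable_cong]: "sets ?P = sets borel" "sets ?N = sets borel"
    by (simp_all add: sets_rds_measure[OF ab] mono)
  have fin: "finite_measure ?P" "finite_measure ?N" by (simp_all add: finite_rds_measure[OF ab] mono)
  interpret P: finite_measure ?P by fact
  interpret N: finite_measure ?N by fact
  have [measurable]: "v k \<in> borel_measurable borel" "u k \<in> borel_measurable borel" for k
    using s[of k] by (auto simp: borel_sandwich_def)
  have eq: "p k t - m k t = p 0 t - m 0 t" if "t \<in> {a..b}" for k t
    using d[of k] d[of 0] that by (auto simp: rds_decomp_def)
  \<comment> \<open>The decompositions vary with \<open>k\<close>, so the exceptional set \<open>E\<close> need not be null for \<open>?P\<close> or \<open>?N\<close>;
    but the two measures agree on its Borel subsets, and \<open>E\<close> contributes nothing to any integral.\<close>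
  define A where "A k = {t. v k t \<noteq> u k t}" for k
  have A_sets [measurable]: "A k \<in> sets borel" for k unfolding A_def by measurable
  define E where "E = (\<Union>k. A k)"
  have E_sets [measurable]: "E \<in> sets borel" unfolding E_def by measurable
  \<comment> \<open>On \<open>A k\<close> the measures of \<open>p k\<close> and \<open>m k\<close>
    vanish, so the crosswise equation with the reference decomposition reduces to equality of
    \<open>?P\<close> and \<open>?N\<close>.\<close>
  have null: "measure ?P B = measure ?N B" if B: "B \<in> sets borel" "B \<subseteq> A k" for B k
  proof -
    have "measure (rds_measure a b (p k)) B = 0"
      using B by (intro borel_sandwich_null[OF ab mono(1) s]) (auto simp: A_def vp up)
    moreover have "measure (rds_measure a b (m k)) B = 0"
      using B by (intro borel_sandwich_null[OF ab mono(2) s]) (auto simp: A_def vm um)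
    ultimately show ?thesis
      using rds_measure_add_eq[OF ab mono mono eq B(1), of k] by simp
  qed
  have E: "measure ?P B = measure ?N B" if B[measurable]: "B \<in> sets borel" and "B \<subseteq> E" for B
  proof -
    \<comment> \<open>Cut B into disjoint pieces, each inside a single \<open>A k\<close>, and add
      up their masses.\<close>
    let ?D = "\<lambda>k. B \<inter> disjointed A k"
    have [measurable]: "disjointed A k \<in> sets borel" for k
      unfolding disjointed_def by measurable
    have disj: "disjoint_family ?D"
      using disjoint_family_disjointed[of A] by (auto simp: disjoint_family_on_def)
    have "(\<Union>k. ?D k) = B" using \<open>B \<subseteq> E\<close> UN_disjointed_eq[of A] by (auto simp: E_def)
    moreover have "(\<lambda>k. measure ?P (?D k)) sums measure ?P (\<Union>k. ?D k)"
      using disj by (intro P.finite_measure_UNION) auto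
    moreover have "(\<lambda>k. measure ?N (?D k)) sums measure ?N (\<Union>k. ?D k)"
      using disj by (intro N.finite_measure_UNION) auto
    moreover have "measure ?P (?D k) = measure ?N (?D k)" for k
      using disjointed_subset[of A k] by (intro null[of _ k]) auto
    ultimately show ?thesis by (simp add: sums_unique2)
  qed
  \<comment> \<open>Move the integral of \<open>v k\<close> to the reference decomposition, then
    split it along E: the parts over E agree for \<open>?P\<close> and \<open>?N\<close> and
    cancel.\<close>
  have int: "rds_integral a b \<alpha> (F k) =
    (LINT t|?P. indicator (- E) t * v k t) - (LINT t|?N. indicator (- E) t * v k t)" for k
  proof -
    obtain K where K: "\<And>t. \<bar>v k t\<bar> \<le> K" using s[of k] unfolding borel_sandwich_def by blast
    have split: "(LINT t|L. v k t) = (LINT t|L. indicator E t * v k t) + (LINT t|L. indicator (- E) t * v k t)"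
      if L: "finite_measure L" and [measurable_cong]: "sets L = sets borel" for L
    proof -
      have "\<bar>indicator B t * v k t\<bar> \<le> K" for B t
        using K[of t] by (auto simp: indicator_def)
      then have i: "integrable L (\<lambda>t. indicator B t * v k t)" if [measurable]: "B \<in> sets borel" for B
        by (intro integrable_bounded_finite_measure[OF L]) auto
      have "(LINT t|L. v k t) = (LINT t|L. indicator E t * v k t + indicator (- E) t * v k t)"
        by (intro Bochner_Integration.integral_cong) (auto simp: indicator_def)
      also have "\<dots> = (LINT t|L. indicator E t * v k t) + (LINT t|L. indicator (- E) t * v k t)"
        by (intro Bochner_Integration.integral_add i) measurable
      finally show ?thesis .
    qed
    have vk: "v k \<in> borel_measurable borel" by measurable
    have "(LINT t|?P. indicator E t * v k t) = (LINT t|?N. indicator E t * v k t)"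
      by (rule integral_eq_on_set) (auto simp: sets P.emeasure_eq_measure N.emeasure_eq_measure E)
    moreover have "rds_integral a b \<alpha> (F k) = (LINT t|?P. v k t) - (LINT t|?N. v k t)"
      using rds_integral_measure_add_eq[OF ab mono(1)[of k] mono(2)[of k] mono(1)[of 0] mono(2)[of 0] eq vk K]
      by (simp add: rds_integral_eq[OF ab d] vp vm)
    ultimately show ?thesis using split[OF fin(1) sets(1)] split[OF fin(2) sets(2)] by simp
  qed
  \<comment> \<open>Off E every sandwich closes, so the Borel functions \<open>v k\<close> inherit
    the pointwise convergence and the uniform bound of the original functions, extended by
    0.\<close>
  have off: "indicator (- E) t * v k t = indicator (- E) t * (indicator {a..b} t * F k t)" for k t
  proof (cases "t \<in> E")
    case False
    then have "v k t = u k t" by (auto simp: E_def A_def)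
    then have "v k t = indicator {a..b} t * F k t"
      using s[of k] unfolding borel_sandwich_def by (metis order_antisym)
    then show ?thesis by simp
  qed simp
  obtain C where C: "\<And>n t. t \<in> {a..b} \<Longrightarrow> \<bar>f n t\<bar> \<le> C" using assms(3) by blast
  \<comment> \<open>The integrands are 0 on E and outside [a,b], so the dominating constant must be
    nonnegative; the bound at the point a shows this.\<close>
  have C0: "0 \<le> C" using C[of a 0] ab by simp
  \<comment> \<open>Dominated convergence for a generic finite Borel measure L, to be used for
    \<open>?P\<close> and \<open>?N\<close> separately; the constant C dominates.\<close>
  have "(\<lambda>n. LINT t|L. indicator (- E) t * v (Suc n) t) \<longlonglongrightarrow> (LINT t|L. indicator (- E) t * v 0 t)"
    if "finite_measure L" and [measurable_cong]: "sets L = sets borel" for L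
  proof (rule integral_dominated_convergence)
    interpret finite_measure L by fact
    show "integrable L (\<lambda>_. C)" by simp
    show "AE t in L. (\<lambda>n. indicator (- E) t * v (Suc n) t) \<longlonglongrightarrow> indicator (- E) t * v 0 t"
      unfolding off F_simps using assms(5)
      by (intro AE_I2) (auto simp: indicator_def)
    show "AE t in L. norm (indicator (- E) t * v (Suc n) t) \<le> C" for n
      unfolding off F_simps using C C0 by (intro AE_I2) (auto simp: indicator_def)
  qed measurable
  from tendsto_diff[OF this[OF fin(1) sets(1)] this[OF fin(2) sets(2)]]
  show ?thesis by (simp add: int[of 0, unfolded F_simps] int[of "Suc n" for n, unfolded F_simps])
qed

end
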